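(* The categories of finite-dimensional unital $C^*$-algebras with (i) Schwarz-positive unital (SPU) maps and (ii) completely positive unital (CPU) maps are a.e. modular. Explicitly: let $\mathcal{A},\mathcal{B},\mathcal{C}$ be finite-dimensional unital $C^*$-algebras and let $F:\mathcal{B}\to\mathcal{A}$, $G:\mathcal{A}\to\mathcal{B}$, $\xi:\mathcal{B}\to\mathcal{C}$ all be SPU (respectively, all be CPU) maps such that $$\xi\big(G(F(B))B'\big)=\xi(BB')\qquad\text{for all }B,B'\in\mathcal{B}.$$ Then $$\xi\big(G(AF(B))B'\big)=\xi\big(G(A)BB'\big)\qquad\text{for all }A\in\mathcal{A},\ B,B'\in\mathcal{B}.$$ Likewise (the right-handed version), if $\xi(B'G(F(B)))=\xi(B'B)$ for all $B,B'\in\mathcal{B}$, then $\xi(B'G(F(B)A))=\xi(B'BG(A))$ for all $A\in\mathcal{A}$, $B,B'\in\mathcal{B}$.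
   Context: A linear map $F:\mathcal{B}\to\mathcal{A}$ of unital $C^*$-algebras is Schwarz-positive unital (SPU) if it is unital and $F(B^*B)\ge F(B)^*F(B)$ for all $B\in\mathcal{B}$; it is completely positive unital (CPU) if it is unital and $\mathrm{id}_{\mathcal{M}_n(\mathbb{C})}\otimes F$ is positive for every $n$. Abstract notion: in a category with copy morphisms $\Delta_X:X\to X\otimes X$, a subcategory is left a.e. modular if for all $f:X\to Y$, $g:Y\to X$, $q:\Theta\to Y$ in it with $((fg)\otimes\mathrm{id}_Y)\Delta_Yq=\Delta_Yq$, one has $(\mathrm{id}_X\otimes f\otimes\mathrm{id}_Y)((\Delta_Xg)\otimes\mathrm{id}_Y)\Delta_Yq=(g\otimes\mathrm{id}_Y\otimes\mathrm{id}_Y)(\Delta_Y\otimes\mathrm{id}_Y)\Delta_Yq$; right a.e. modularity is the mirror image. For $C^*$-algebras one works in the opposite category with copy given by multiplication $A\otimes A'\mapsto AA'$, and these conditions become the explicit ones in the claim. For subcategories of $*$-preserving maps, left and right a.e. modularity are equivalent. *)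

theory Defs
  imports Complex_Main
begin

text \<open>The axiom \<open>0 \<noteq> 1\<close> is not imposed (hence \<^class>\<open>real_normed_algebra\<close> plus
  \<^class>\<open>monoid_mult\<close> instead of \<^class>\<open>real_normed_algebra_1\<close>), so the zero algebra is a
  unital \<open>C\<close>-star algebra.\<close>

class cstar_algebra = real_normed_algebra + banach + monoid_mult +
  fixes scaleC :: "complex \<Rightarrow> 'a \<Rightarrow> 'a"
    and star :: "'a \<Rightarrow> 'a"
  assumes scaleC_add_right: "scaleC z (x + y) = scaleC z x + scaleC z y"
    and scaleC_add_left: "scaleC (z + w) x = scaleC z x + scaleC w x"
    and scaleC_scaleC: "scaleC z (scaleC w x) = scaleC (z * w) x"
    and scaleC_one: "scaleC 1 x = x"
    and scaleR_scaleC: "scaleR r x = scaleC (complex_of_real r) x"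
    and mult_scaleC_left_cstar: "scaleC z x * y = scaleC z (x * y)"
    and mult_scaleC_right_cstar: "x * scaleC z y = scaleC z (x * y)"
    and norm_scaleC: "norm (scaleC z x) = cmod z * norm x"
    and star_star: "star (star x) = x"
    and star_add: "star (x + y) = star x + star y"
    and star_scaleC: "star (scaleC z x) = scaleC (cnj z) (star x)"
    and star_mult: "star (x * y) = star y * star x"
    and cstar_identity: "norm (star x * x) = (norm x)\<^sup>2"

class fd_cstar_algebra = cstar_algebra +
  assumes finite_dim: "\<exists>S. finite S \<and> (\<forall>x. \<exists>c. x = (\<Sum>s\<in>S. scaleC (c s) s))"

lemma vector_space_scaleC: "vector_space (scaleC :: complex \<Rightarrow> 'a \<Rightarrow> 'a::cstar_algebra)"
  by unfold_locales
    (simp_all add: scaleC_add_right scaleC_add_left scaleC_scaleC scaleC_one)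

definition cstar_pos :: "'a::cstar_algebra \<Rightarrow> bool" where
  "cstar_pos x \<longleftrightarrow> (\<exists>y. x = star y * y)"

definition cstar_le :: "'a::cstar_algebra \<Rightarrow> 'a \<Rightarrow> bool" where
  "cstar_le x y \<longleftrightarrow> cstar_pos (y - x)"

text \<open>Complex-linear maps are \<open>Vector_Spaces.linear scaleC scaleC\<close>; the unqualified
  \<open>linear\<close> of the library means real-linear.\<close>

definition SPU :: "('b::cstar_algebra \<Rightarrow> 'a::cstar_algebra) \<Rightarrow> bool" where
  "SPU F \<longleftrightarrow> Vector_Spaces.linear scaleC scaleC F \<and> F 1 = 1 \<and>
     (\<forall>b. cstar_le (star (F b) * F b) (F (star b * b)))"

text \<open>The algebra \<open>M\<^sub>n(\<complex>) \<otimes> \<A>\<close> is \<open>M\<^sub>n(\<A>)\<close>: an element is given by the entries \<open>X i j\<close> with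
  \<open>i, j < n\<close> (other entries are irrelevant), products are matrix products, and the involution is
  \<open>(Y\<^sup>*) i k = star (Y k i)\<close>. As in \<open>\<A>\<close> itself, positive means of the form \<open>Y\<^sup>* Y\<close>.
  The map \<open>id \<otimes> F\<close> becomes entrywise application of \<open>F\<close>.\<close>

definition mat_pos :: "nat \<Rightarrow> (nat \<Rightarrow> nat \<Rightarrow> 'a::cstar_algebra) \<Rightarrow> bool" where
  "mat_pos n X \<longleftrightarrow> (\<exists>Y. \<forall>i<n. \<forall>j<n. X i j = (\<Sum>k<n. star (Y k i) * Y k j))"

definition CPU :: "('b::cstar_algebra \<Rightarrow> 'a::cstar_algebra) \<Rightarrow> bool" where
  "CPU F \<longleftrightarrow> Vector_Spaces.linear scaleC scaleC F \<and> F 1 = 1 \<and>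
     (\<forall>n X. mat_pos n X \<longrightarrow> mat_pos n (\<lambda>i j. F (X i j)))"

end

theory Submission
  imports Defs "HOL-Computational_Algebra.Fundamental_Theorem_Algebra"
begin

text \<open>A finite-dimensional \<open>C\<close>-star algebra has enough minimal projections: every left
  ideal is generated by a sum of them, and each \<open>e\<close> carries the positive functional \<open>\<phi>\<close> with
  \<open>e * x * e = \<phi> x e\<close>. Hence there is a faithful positive functional, and composing \<open>\<xi>\<close> with it
  reduces the claim to a positive functional \<open>\<omega>\<close>. The hypothesis says that \<open>G (F b)\<close> and
  \<open>b\<close> agree on the support \<open>p\<close> of \<open>\<omega>\<close>; the Schwarz inequality for elements \<open>y = p * y\<close>
  upgrades this to agreement on the ideal generated by \<open>p\<close>, that is, in the GNS
  representation of \<open>\<omega>\<close>. There the Schwarz inequalities for \<open>F\<close> and \<open>G\<close> are squeezed to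
  equalities, which puts \<open>F b\<close> in the multiplicative domain of \<open>G\<close>.\<close>

section \<open>Arithmetic of the involution and of complex scalars\<close>

interpretation cvs: vector_space "scaleC :: complex \<Rightarrow> 'a \<Rightarrow> 'a::cstar_algebra"
  by (rule vector_space_scaleC)

lemma star_zero [simp]: "star (0::'a::cstar_algebra) = 0"
  using star_add[of 0 "0::'a"] by simp

lemma star_minus: "star (- x) = - star (x::'a::cstar_algebra)"
  using star_add[of x "- x"] by (simp add: eq_neg_iff_add_eq_0 add.commute)

lemma star_diff: "star (x - y) = star x - star (y::'a::cstar_algebra)"
  using star_add[of x "- y"] by (simp add: star_minus)

lemma star_one [simp]: "star (1::'a::cstar_algebra) = 1"
  by (metis mult.right_neutral star_mult star_star)

lemma star_sum: "star (sum f A) = (\<Sum>a\<in>A. star (f a :: 'a::cstar_algebra))"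
  by (induction A rule: infinite_finite_induct) (simp_all add: star_add)

lemmas star_simps = star_add star_minus star_diff star_mult star_scaleC

lemma star_mult_self_eq_0_iff [simp]: "star x * x = 0 \<longleftrightarrow> x = (0::'a::cstar_algebra)"
  using cstar_identity[of x] by auto

lemma clinear_iff:
  "Vector_Spaces.linear scaleC scaleC (F :: 'b::cstar_algebra \<Rightarrow> 'a::cstar_algebra) \<longleftrightarrow>
     (\<forall>x y. F (x + y) = F x + F y) \<and> (\<forall>c x. F (scaleC c x) = scaleC c (F x))"
  by (simp add: linear_iff_module_hom module_hom_iff cvs.module_axioms)

section \<open>Minimal projections\<close>

definition left_ideal :: "'a::cstar_algebra set \<Rightarrow> bool" where
  "left_ideal L \<longleftrightarrow> cvs.subspace L \<and> (\<forall>b. \<forall>x\<in>L. b * x \<in> L)"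

text \<open>Minimality is encoded as one-dimensionality of the corner of all
  \<open>e * x * e\<close>; the scalar \<open>c\<close>, as a function of \<open>x\<close>, later
  becomes a positive functional.\<close>

definition min_proj :: "'a::cstar_algebra \<Rightarrow> bool" where
  "min_proj e \<longleftrightarrow> e \<noteq> 0 \<and> star e = e \<and> e * e = e \<and> (\<forall>x. \<exists>c. e * x * e = scaleC c e)"

lemma finite_cbasis:
  obtains B :: "'a::fd_cstar_algebra set"
  where "finite_dimensional_vector_space (scaleC :: complex \<Rightarrow> 'a \<Rightarrow> 'a) B"
proof -
  obtain S :: "'a set" where S: "finite S" "\<And>x. \<exists>c. x = (\<Sum>s\<in>S. scaleC (c s) s)"
    using finite_dim by blast
  have sp: "x \<in> cvs.span S" for x
  proof -
    obtain c where "x = (\<Sum>s\<in>S. scaleC (c s) s)" using S(2) by blast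
    then show ?thesis by (simp add: cvs.span_sum cvs.span_scale cvs.span_base)
  qed
  obtain B :: "'a set" where B: "B \<subseteq> UNIV" "cvs.independent B" "UNIV \<subseteq> cvs.span B"
    using cvs.maximal_independent_subset[of "UNIV::'a set"] by blast
  have "finite B" using cvs.independent_span_bound[OF S(1) B(2)] sp by auto
  then show ?thesis using B by (intro that) (unfold_locales, auto)
qed

lemma cdim_psubset:
  fixes S T :: "'a::fd_cstar_algebra set"
  assumes "cvs.subspace S" "cvs.subspace T" "S \<subset> T"
  shows "cvs.dim S < cvs.dim T"
proof -
  obtain B :: "'a set" where "finite_dimensional_vector_space (scaleC :: complex \<Rightarrow> 'a \<Rightarrow> 'a) B"
    by (rule finite_cbasis)
  then interpret finite_dimensional_vector_space "scaleC :: complex \<Rightarrow> 'a \<Rightarrow> 'a" B .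
  show ?thesis using assms by (intro dim_psubset) (simp add: cvs.span_eq_iff[THEN iffD2])
qed

text \<open>Strict inclusion of subspaces lowers the complex dimension, so induction over left
  ideals is well-founded.\<close>

lemma left_ideal_induct [consumes 1, case_names less]:
  fixes L :: "'a::fd_cstar_algebra set"
  assumes "left_ideal L"
    and step: "\<And>L. left_ideal L \<Longrightarrow> (\<And>M. left_ideal M \<Longrightarrow> M \<subset> L \<Longrightarrow> P M) \<Longrightarrow> P L"
  shows "P L"
  using assms(1)
proof (induction "cvs.dim L" arbitrary: L rule: less_induct)
  case less
  then show ?case using step[of L] cdim_psubset[of _ L] by (auto simp: left_ideal_def)
qed

lemma left_idealD:
  assumes "left_ideal L"
  shows "0 \<in> L" "x \<in> L \<Longrightarrow> y \<in> L \<Longrightarrow> x + y \<in> L" "x \<in> L \<Longrightarrow> y \<in> L \<Longrightarrow> x - y \<in> L"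
    "x \<in> L \<Longrightarrow> b * x \<in> L"
  using assms by (auto simp: left_ideal_def cvs.subspace_0 cvs.subspace_add cvs.subspace_diff)

lemma left_ideal_principal: "left_ideal (range (\<lambda>b. b * (x::'a::cstar_algebra)))"
  unfolding left_ideal_def cvs.subspace_def
proof (intro conjI ballI allI)
  show "0 \<in> range (\<lambda>b. b * x)" by (metis mult_zero_left rangeI)
next
  fix u v assume "u \<in> range (\<lambda>b. b * x)" "v \<in> range (\<lambda>b. b * x)"
  then show "u + v \<in> range (\<lambda>b. b * x)" by (auto simp flip: distrib_right)
next
  fix c u assume "u \<in> range (\<lambda>b. b * x)"
  then show "scaleC c u \<in> range (\<lambda>b. b * x)" by (auto simp flip: mult_scaleC_left_cstar)
next
  fix b u assume "u \<in> range (\<lambda>b. b * x)"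
  then show "b * u \<in> range (\<lambda>b. b * x)" by (auto simp flip: mult.assoc)
qed

text \<open>Horner evaluation with \<open>e\<close> as the unit: \<open>p\<close> goes to the sum of
  the terms \<open>scaleC (coeff p i) (b ^ i * e)\<close>.\<close>

definition peval :: "'a::cstar_algebra \<Rightarrow> 'a \<Rightarrow> complex poly \<Rightarrow> 'a" where
  "peval e b p = fold_coeffs (\<lambda>a y. scaleC a e + b * y) p 0"

lemma peval_0 [simp]: "peval e b 0 = 0"
  by (simp add: peval_def)

lemma peval_pCons [simp]: "peval e b (pCons a p) = scaleC a e + b * peval e b p"
  by (cases "p = 0 \<and> a = 0") (auto simp: peval_def)

lemma peval_add: "peval e b (p + q) = peval e b p + peval e b q"
  by (induction p q rule: poly_induct2) (simp_all add: algebra_simps scaleC_add_left)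

lemma peval_smult: "peval e b (smult c p) = scaleC c (peval e b p)"
  by (induction p) (simp_all add: scaleC_add_right scaleC_scaleC mult_scaleC_right_cstar)

lemma peval_sum: "peval e b (sum f A) = (\<Sum>a\<in>A. peval e b (f a))"
  by (induction A rule: infinite_finite_induct) (simp_all add: peval_add)

lemma ex_annihilating_poly:
  fixes e b :: "'a::fd_cstar_algebra"
  obtains p where "p \<noteq> 0" "peval e b p = 0"
proof -
  obtain B :: "'a set" where "finite_dimensional_vector_space (scaleC :: complex \<Rightarrow> 'a \<Rightarrow> 'a) B"
    by (rule finite_cbasis)
  then interpret finite_dimensional_vector_space "scaleC :: complex \<Rightarrow> 'a \<Rightarrow> 'a" B .
  define f where "f i = peval e b (monom 1 i)" for i
  \<comment> \<open>Linear dependence of the set \<open>range f\<close> does not see repeated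
    values, so coinciding powers are treated separately.\<close>
  show ?thesis
  proof (cases "inj f")
    case False
    then obtain i j where ij: "i \<noteq> j" "f i = f j" by (auto simp: inj_def)
    let ?p = "monom 1 i + smult (- 1) (monom 1 j) :: complex poly"
    have "coeff ?p i \<noteq> coeff 0 i" using ij(1) by simp
    then have "?p \<noteq> 0" by metis
    moreover have "peval e b ?p = 0" using ij(2) unfolding peval_add peval_smult f_def by simp
    ultimately show ?thesis by (rule that)
  next
    case True
    then have inj: "inj_on f A" for A by (rule inj_on_subset) simp
    have "cvs.dependent (range f)"
      using finiteI_independent[of "range f"] range_inj_infinite[OF True] by blast
    then obtain T u v where T: "finite T" "T \<subseteq> range f" "(\<Sum>v\<in>T. scaleC (u v) v) = 0"
      "v \<in> T" "u v \<noteq> 0"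
      unfolding cvs.dependent_explicit by blast
    obtain A where A: "T = f ` A" using T(2) by (metis subset_imageE)
    have fA: "finite A" using T(1) inj unfolding A by (metis finite_imageD)
    obtain k where k: "k \<in> A" "v = f k" using T(4) A by blast
    let ?p = "\<Sum>i\<in>A. smult (u (f i)) (monom 1 i)"
    have "coeff ?p k = (\<Sum>i\<in>A. if i = k then u (f i) else 0)"
      by (simp add: coeff_sum if_distrib cong: if_cong)
    also have "\<dots> = u v" using fA k by simp
    finally have "?p \<noteq> 0" using T(5) by force
    moreover have "peval e b ?p = 0"
      using T(3) unfolding A peval_sum peval_smult by (simp add: sum.reindex[OF inj] flip: f_def)
    ultimately show ?thesis by (rule that)
  qed
qed

text \<open>If \<open>e * B * e\<close> is a division algebra it is \<open>\<complex> e\<close>: a zero of an annihilating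
  polynomial of minimal degree gives the scalar.\<close>

lemma division_corner_scalar:
  fixes e b :: "'a::fd_cstar_algebra"
  assumes e: "e * e = e" and b: "e * b = b" "b * e = b"
    and div: "\<And>d. e * d = d \<Longrightarrow> d * e = d \<Longrightarrow> d \<noteq> 0 \<Longrightarrow> \<exists>y. y * d = e"
  shows "\<exists>c. b = scaleC c e"
proof (cases "e = 0")
  case True
  then show ?thesis using b by auto
next
  case e0: False
  let ?P = "\<lambda>p. p \<noteq> 0 \<and> peval e b p = 0"
  obtain p0 where "?P p0" using ex_annihilating_poly[of e b] by blast
  then obtain p where p: "?P p" and min: "\<And>q. ?P q \<Longrightarrow> degree p \<le> degree q"
    using ex_has_least_nat[of ?P p0 degree] by blast
  have "degree p \<noteq> 0"
  proof
    assume "degree p = 0"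
    then obtain a where "p = [:a:]" by (metis degree_eq_zeroE)
    then show False using p e0 by auto
  qed
  then obtain z where "poly p z = 0"
    using fundamental_theorem_of_algebra[of p] by (auto simp: constant_degree)
  then obtain q where q: "p = [:- z, 1:] * q" using poly_eq_0_iff_dvd dvdE by metis
  have q0: "q \<noteq> 0" using p q by auto
  have "degree p = Suc (degree q)" unfolding q using q0 by (subst degree_mult_eq) auto
  then have pq: "peval e b q \<noteq> 0" using min[of q] q0 by auto
  have eq: "e * peval e b q = peval e b q"
    by (induction q) (simp_all add: e distrib_left mult_scaleC_right_cstar b flip: mult.assoc)
  have "p = smult (- z) q + pCons 0 q" unfolding q by simp
  then have "peval e b p = b * peval e b q - scaleC z (peval e b q)"
    by (simp only: peval_add peval_smult peval_pCons) simp
  then have pz: "(b - scaleC z e) * peval e b q = 0"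
    using p by (simp add: left_diff_distrib mult_scaleC_left_cstar eq)
  \<comment> \<open>A left inverse in the corner would cancel in \<open>pz\<close> and force
    \<open>peval e b q = 0\<close>.\<close>
  have "b - scaleC z e = 0"
  proof (rule ccontr)
    assume "b - scaleC z e \<noteq> 0"
    moreover have "e * (b - scaleC z e) = b - scaleC z e" "(b - scaleC z e) * e = b - scaleC z e"
      by (simp_all add: algebra_simps mult_scaleC_left_cstar mult_scaleC_right_cstar b e)
    ultimately obtain y where "y * (b - scaleC z e) = e" using div by blast
    then have "e * peval e b q = 0" using pz by (metis mult.assoc mult_zero_right)
    then show False using eq pq by simp
  qed
  then show ?thesis by auto
qed

text \<open>After descending to an ideal with no smaller nonzero one, every nonzero element
  generates it. Solving \<open>h = r * (h * h)\<close> for a self-adjoint \<open>h\<close> yields a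
  projection \<open>r * h\<close>, and each nonzero \<open>d\<close> in its corner has a left
  inverse, so the corner is scalar.\<close>

lemma left_ideal_contains_min_proj:
  fixes L :: "'a::fd_cstar_algebra set"
  assumes "left_ideal L" "x \<in> L" "x \<noteq> 0"
  shows "\<exists>e\<in>L. min_proj e"
  using assms
proof (induction L arbitrary: x rule: left_ideal_induct)
  case (less L)
  show ?case
  proof (cases "\<exists>M y. left_ideal M \<and> M \<subset> L \<and> y \<in> M \<and> y \<noteq> 0")
    case True
    then show ?thesis using less.IH by blast
  next
    case False
    have princ: "range (\<lambda>b. b * y) = L" if "y \<in> L" "y \<noteq> 0" for y
    proof -
      have "range (\<lambda>b. b * y) \<subseteq> L" using left_idealD(4)[OF less.hyps that(1)] by auto
      moreover have "y \<in> range (\<lambda>b. b * y)" by (metis mult_1 rangeI)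
      ultimately show ?thesis using False left_ideal_principal[of y] that by blast
    qed
    define h where "h = star x * x"
    have hs: "star h = h" by (simp add: h_def star_mult star_star)
    have hL: "h \<in> L" using left_idealD(4) less.hyps less.prems h_def by blast
    have h0: "h \<noteq> 0" using less.prems by (simp add: h_def)
    have "h * h \<noteq> 0" using h0 star_mult_self_eq_0_iff[of h] hs by simp
    then obtain r where r: "h = r * (h * h)"
      using princ[of "h * h"] hL left_idealD(4)[OF less.hyps hL] by fast
    define e where "e = r * h"
    \<comment> \<open>Taking stars gives \<open>h = h * star e\<close>, and multiplying by
      \<open>r\<close> gives \<open>e = e * star e\<close>.\<close>
    have "h = e * h" using r by (simp add: e_def mult.assoc)
    then have "h = h * star e" by (metis hs star_mult)
    then have "e * star e = e" by (metis e_def mult.assoc)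
    then have es: "star e = e" by (metis star_mult star_star)
    then have ee: "e * e = e" using \<open>e * star e = e\<close> by simp
    have eL: "e \<in> L" using left_idealD(4)[OF less.hyps hL] by (simp add: e_def)
    have e0: "e \<noteq> 0" using \<open>h = e * h\<close> h0 by auto
    have "\<exists>c. e * y * e = scaleC c e" for y
    proof (rule division_corner_scalar)
      fix d assume "d * e = d" "d \<noteq> 0"
      then have "d \<in> L" using left_idealD(4)[OF less.hyps eL] by metis
      then show "\<exists>y. y * d = e" using princ[of d] \<open>d \<noteq> 0\<close> eL by blast
    qed (simp_all add: ee mult.assoc, simp_all add: ee flip: mult.assoc)
    then show ?thesis using e0 es ee eL by (auto simp: min_proj_def)
  qed
qed

text \<open>Splitting off a minimal projection \<open>e\<close> leaves the smaller left ideal of all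
  \<open>n\<close> with \<open>n * e = 0\<close>. Its right unit is orthogonal to \<open>e\<close>,
  and adding \<open>e\<close> gives a right unit of \<open>N\<close>.\<close>

lemma left_ideal_unit:
  fixes N :: "'a::fd_cstar_algebra set"
  assumes "left_ideal N"
  shows "\<exists>es. (\<forall>e\<in>set es. min_proj e) \<and> sum_list es \<in> N \<and>
           star (sum_list es) = sum_list es \<and> (\<forall>n\<in>N. n * sum_list es = n)"
  using assms
proof (induction N rule: left_ideal_induct)
  case (less N)
  show ?case
  proof (cases "\<exists>x\<in>N. x \<noteq> 0")
    case False
    then show ?thesis using left_idealD(1)[OF less.hyps] by (intro exI[of _ "[]"]) auto
  next
    case True
    then obtain e where e: "e \<in> N" "min_proj e"
      using left_ideal_contains_min_proj[OF less.hyps] by blast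
    then have e': "e \<noteq> 0" "star e = e" "e * e = e" by (auto simp: min_proj_def)
    define M where "M = {n \<in> N. n * e = 0}"
    have "left_ideal M"
      using less.hyps unfolding M_def left_ideal_def cvs.subspace_def
      by (auto simp: distrib_right mult_scaleC_left_cstar mult.assoc)
    moreover have "e \<notin> M" using e' by (simp add: M_def)
    then have "M \<subset> N" using e(1) by (auto simp: M_def)
    ultimately obtain es where es: "\<forall>e\<in>set es. min_proj e" "sum_list es \<in> M"
      "star (sum_list es) = sum_list es" "\<forall>n\<in>M. n * sum_list es = n"
      using less.IH by metis
    let ?g = "sum_list es"
    have "?g * e = 0" using es(2) by (simp add: M_def)
    then have eg: "e * ?g = 0" by (metis es(3) e'(2) star_mult star_zero)
    have "n * (e + ?g) = n" if n: "n \<in> N" for n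
    proof -
      have "n - n * e \<in> M"
        using left_idealD(3)[OF less.hyps n left_idealD(4)[OF less.hyps e(1)]]
        by (simp add: M_def left_diff_distrib mult.assoc e')
      then have "(n - n * e) * ?g = n - n * e" using es(4) by blast
      then show ?thesis by (simp add: left_diff_distrib distrib_left mult.assoc eg)
    qed
    moreover have "e + ?g \<in> N" using left_idealD(2)[OF less.hyps e(1)] es(2) by (auto simp: M_def)
    ultimately show ?thesis using es e e'
      by (intro exI[of _ "e # es"]) (auto simp: star_add)
  qed
qed

section \<open>Positive functionals\<close>

text \<open>Degenerate Cauchy-Schwarz: at \<open>x + scaleC t b\<close> the form is affine in real
  multiples of \<open>t\<close>, and an affine function bounded below is constant. The values
  \<open>t = 1\<close> and \<open>t = \<i>\<close> then isolate \<open>s x b\<close>.\<close>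

lemma sesquilinear_eq_0:
  fixes s :: "'a::cstar_algebra \<Rightarrow> 'a \<Rightarrow> complex"
  assumes add: "\<And>x y z. s (x + y) z = s x z + s y z" "\<And>x y z. s z (x + y) = s z x + s z y"
    and scale: "\<And>c x y. s (scaleC c x) y = cnj c * s x y" "\<And>c x y. s x (scaleC c y) = c * s x y"
    and pos: "\<And>x. Im (s x x) = 0" "\<And>x. 0 \<le> Re (s x x)"
    and zero: "Re (s b b) \<le> 0"
  shows "s x b = 0"
proof -
  have sb: "s b b = 0" using pos[of b] zero by (simp add: complex_eq_iff)
  have E: "s (x + scaleC t b) (x + scaleC t b) = s x x + (t * s x b + cnj t * s b x)" for t
    by (simp add: add scale sb)
  have lin: "d = 0" if "\<And>r::real. 0 \<le> a + r * d" for a d :: real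
  proof (rule ccontr)
    assume "d \<noteq> 0"
    then show False using that[of "- (a + 1) / d"] by simp
  qed
  have Re0: "Re (t * s x b + cnj t * s b x) = 0" for t
  proof (rule lin)
    fix r :: real
    show "0 \<le> Re (s x x) + r * Re (t * s x b + cnj t * s b x)"
      using pos(2)[of "x + scaleC (of_real r * t) b"] unfolding E by (simp add: algebra_simps)
  qed
  have "Im (t * s x b + cnj t * s b x) = 0" for t
    using pos(1)[of "x + scaleC t b"] unfolding E by (simp add: pos)
  from this[of 1] this[of \<i>] Re0[of 1] Re0[of \<i>] show ?thesis
    by (simp add: complex_eq_iff)
qed

definition pos_functional :: "('a::cstar_algebra \<Rightarrow> complex) \<Rightarrow> bool" where
  "pos_functional \<phi> \<longleftrightarrow> (\<forall>x y. \<phi> (x + y) = \<phi> x + \<phi> y) \<and> (\<forall>c x. \<phi> (scaleC c x) = c * \<phi> x) \<and>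
     (\<forall>x. Im (\<phi> (star x * x)) = 0 \<and> 0 \<le> Re (\<phi> (star x * x)))"

lemma pos_functionalD:
  assumes "pos_functional \<phi>"
  shows "\<phi> (x + y) = \<phi> x + \<phi> y" "\<phi> (scaleC c x) = c * \<phi> x"
    "Im (\<phi> (star x * x)) = 0" "0 \<le> Re (\<phi> (star x * x))"
    "\<phi> 0 = 0" "\<phi> (- x) = - \<phi> x" "\<phi> (x - y) = \<phi> x - \<phi> y"
proof -
  show a: "\<phi> (x + y) = \<phi> x + \<phi> y" for x y using assms by (auto simp: pos_functional_def)
  show "\<phi> (scaleC c x) = c * \<phi> x" "Im (\<phi> (star x * x)) = 0" "0 \<le> Re (\<phi> (star x * x))"
    using assms by (auto simp: pos_functional_def)
  show z: "\<phi> 0 = 0" using a[of 0 0] by simp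
  show m: "\<phi> (- x) = - \<phi> x" for x using a[of x "- x"] z by (simp add: eq_neg_iff_add_eq_0 add.commute)
  show "\<phi> (x - y) = \<phi> x - \<phi> y" using a[of x "- y"] m[of y] by simp
qed

text \<open>Polarization: \<phi> is real on the square of \<open>1 + scaleC t x\<close> for
  \<open>t = 1\<close> and \<open>t = \<i>\<close>.\<close>

lemma pos_functional_star:
  assumes "pos_functional \<phi>"
  shows "\<phi> (star x) = cnj (\<phi> x)"
proof -
  have "star (1 + scaleC t x) * (1 + scaleC t x) =
      1 + (scaleC t x + scaleC (cnj t) (star x)) + scaleC (cnj t * t) (star x * x)" for t
    by (simp add: star_simps algebra_simps mult_scaleC_left_cstar mult_scaleC_right_cstar scaleC_scaleC)
  then have "Im (\<phi> (1 + (scaleC t x + scaleC (cnj t) (star x)) + scaleC (cnj t * t) (star x * x))) = 0" for t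
    using pos_functionalD(3)[OF assms] by metis
  moreover have "Im (\<phi> 1) = 0" using pos_functionalD(3)[OF assms, of 1] by simp
  ultimately have "Im (t * \<phi> x + cnj t * \<phi> (star x)) = 0" for t
    using pos_functionalD(3)[OF assms, of x] by (simp add: pos_functionalD[OF assms])
  from this[of 1] this[of \<i>] show ?thesis by (simp add: complex_eq_iff)
qed

text \<open>In the GNS form \<open>\<phi> (star x * y)\<close> the element \<open>b\<close> is a
  null vector, hence orthogonal to everything.\<close>

lemma pos_functional_null:
  assumes "pos_functional \<phi>" "Re (\<phi> (star b * b)) \<le> 0"
  shows "\<phi> (x * b) = 0"
  using sesquilinear_eq_0[of "\<lambda>x y. \<phi> (star x * y)" b "star x"] assms
  by (simp add: pos_functionalD[OF assms(1)] star_simps star_star algebra_simps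
      mult_scaleC_left_cstar mult_scaleC_right_cstar)

lemma pos_functional_conj:
  assumes "pos_functional \<phi>"
  shows "pos_functional (\<lambda>b. \<phi> (star x * b * x))"
proof -
  have "star x * (star y * y) * x = star (y * x) * (y * x)" for y
    by (simp add: star_mult mult.assoc)
  then show ?thesis
    using assms by (simp add: pos_functional_def distrib_left distrib_right
      mult_scaleC_left_cstar mult_scaleC_right_cstar)
qed

lemma pos_functional_zero_of_one:
  assumes "pos_functional \<phi>" "\<phi> 1 = 0"
  shows "\<phi> x = 0"
  using pos_functional_null[OF assms(1), of 1 x] assms(2) by simp

text \<open>If \<open>c\<close> were negative, then, after subtracting the component of \<open>y\<close> along \<open>e\<close>, adding
  a suitable multiple of \<open>e\<close> would give \<open>z \<noteq> 0\<close> with \<open>star z * z = 0\<close>.\<close>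

lemma min_proj_square:
  assumes e: "min_proj e" and y: "y * e = y" "star y * y = scaleC c e"
  shows "Im c = 0 \<and> 0 \<le> Re c"
proof -
  have e': "e \<noteq> 0" "star e = e" "e * e = e" using e by (auto simp: min_proj_def)
  have "star (star y * y) = star y * y" by (simp add: star_mult star_star)
  then have "scaleC (cnj c) e = scaleC c e" by (simp add: y star_scaleC e')
  then have cc: "cnj c = c" using e' by simp
  have "0 \<le> Re c"
  proof (rule ccontr)
    assume neg: "\<not> 0 \<le> Re c"
    obtain m where "e * y * e = scaleC m e" using e by (auto simp: min_proj_def)
    then have m: "e * y = scaleC m e" by (simp add: mult.assoc y)
    define w where "w = y - scaleC m e"
    have ew: "e * w = 0" by (simp add: w_def right_diff_distrib mult_scaleC_right_cstar m e')
    then have we: "star w * e = 0" by (metis star_mult star_zero e'(2))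
    have "star w * w = star w * y"
      by (subst (2) w_def) (simp add: right_diff_distrib mult_scaleC_right_cstar we)
    also have "\<dots> = scaleC (c - cnj m * m) e"
      by (simp add: w_def star_simps left_diff_distrib mult_scaleC_left_cstar y e' m scaleC_scaleC
        cvs.scale_left_diff_distrib)
    finally have ww: "star w * w = scaleC (c - cnj m * m) e" .
    \<comment> \<open>This \<open>a\<close> makes the square of \<open>scaleC (of_real a) e\<close>
      cancel \<open>star w * w\<close>.\<close>
    define a where "a = sqrt ((cmod m)\<^sup>2 - Re c)"
    have "(cmod m)\<^sup>2 - Re c > 0" using neg zero_le_power2[of "cmod m"] by linarith
    then have a: "a > 0" and "a\<^sup>2 = (cmod m)\<^sup>2 - Re c" by (simp_all add: a_def)
    moreover have "c = of_real (Re c)" using cc by (simp add: complex_eq_iff)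
    ultimately have aa: "complex_of_real a * of_real a = cnj m * m - c"
      by (metis complex_norm_square mult.commute of_real_diff power2_eq_square of_real_mult)
    define z where "z = scaleC (of_real a) e + w"
    have "star z * z = 0"
      by (simp add: z_def star_simps distrib_left distrib_right mult_scaleC_left_cstar
        mult_scaleC_right_cstar e' ew we ww scaleC_scaleC aa flip: scaleC_add_left)
    then have "e * z = 0" by simp
    then show False using a e' by (simp add: z_def distrib_left mult_scaleC_right_cstar ew)
  qed
  then show ?thesis using cc by (simp add: complex_eq_iff)
qed

text \<open>Positivity: \<open>\<phi> (star x * x)\<close> is the scalar belonging to the square of
  \<open>x * e\<close>, so \<open>min_proj_square\<close> applies.\<close>

lemma min_proj_functional:
  assumes e: "min_proj e"
  obtains \<phi> where "pos_functional \<phi>" "\<And>x. e * x * e = scaleC (\<phi> x) e"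
proof -
  have e': "e \<noteq> 0" "star e = e" "e * e = e" using e by (auto simp: min_proj_def)
  obtain \<phi> where \<phi>: "\<And>x. e * x * e = scaleC (\<phi> x) e"
    using e unfolding min_proj_def by metis
  have eq: "\<phi> x = c" if "e * x * e = scaleC c e" for x c
    using that \<phi>[of x] e' by simp
  have "\<phi> (x + y) = \<phi> x + \<phi> y" for x y
    by (rule eq) (simp add: distrib_left distrib_right \<phi> scaleC_add_left)
  moreover have "\<phi> (scaleC c x) = c * \<phi> x" for c x
    by (rule eq) (simp add: mult_scaleC_left_cstar mult_scaleC_right_cstar \<phi> scaleC_scaleC)
  moreover have "Im (\<phi> (star x * x)) = 0 \<and> 0 \<le> Re (\<phi> (star x * x))" for x
  proof (rule min_proj_square[OF e, of "x * e"])
    show "star (x * e) * (x * e) = scaleC (\<phi> (star x * x)) e"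
      using \<phi>[of "star x * x"] by (simp add: star_mult mult.assoc e')
  qed (simp add: mult.assoc e')
  ultimately show ?thesis using that[of \<phi>] \<phi> by (simp add: pos_functional_def)
qed

text \<open>The whole algebra is a left ideal, and its right unit is \<open>1\<close>.\<close>

lemma unit_sum_min_proj:
  obtains es :: "'a::fd_cstar_algebra list"
  where "\<And>e. e \<in> set es \<Longrightarrow> min_proj e" "sum_list es = 1"
proof -
  have "left_ideal (UNIV :: 'a set)" by (simp add: left_ideal_def)
  from left_ideal_unit[OF this] that show ?thesis by (metis UNIV_I mult_1)
qed

lemma sum_list_mult_right: "(y::'a::cstar_algebra) * sum_list xs = (\<Sum>x\<leftarrow>xs. y * x)"
  by (induction xs) (simp_all add: distrib_left)

text \<open>Add up the functionals of minimal projections with sum \<open>1\<close>. If the total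
  vanishes at \<open>star x * x\<close>, then \<open>x * e = 0\<close> for each of them, hence
  \<open>x = 0\<close>.\<close>

lemma ex_faithful_functional:
  obtains \<psi> :: "'a::fd_cstar_algebra \<Rightarrow> complex"
  where "pos_functional \<psi>" "\<And>x. Re (\<psi> (star x * x)) \<le> 0 \<Longrightarrow> x = 0"
proof -
  have ind: "\<exists>\<psi>. pos_functional \<psi> \<and> (\<forall>x. Re (\<psi> (star x * x)) \<le> 0 \<longrightarrow> (\<forall>e\<in>set es. x * e = 0))"
    if "\<forall>e\<in>set es. min_proj e" for es :: "'a list"
    using that
  proof (induction es)
    case Nil
    then show ?case by (intro exI[of _ "\<lambda>_. 0"]) (simp add: pos_functional_def)
  next
    case (Cons e es)
    then obtain \<psi> where \<psi>: "pos_functional \<psi>"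
      "\<And>x. Re (\<psi> (star x * x)) \<le> 0 \<Longrightarrow> \<forall>e\<in>set es. x * e = 0" by auto
    have e: "min_proj e" using Cons.prems by simp
    obtain \<phi> where \<phi>: "pos_functional \<phi>" "\<And>x. e * x * e = scaleC (\<phi> x) e"
      using min_proj_functional[OF e] by blast
    have "pos_functional (\<lambda>x. \<phi> x + \<psi> x)"
      using \<phi>(1) \<psi>(1) by (simp add: pos_functional_def algebra_simps)
    moreover have "\<forall>e\<in>set (e # es). x * e = 0"
      if "Re (\<phi> (star x * x) + \<psi> (star x * x)) \<le> 0" for x
    proof -
      have "Re (\<phi> (star x * x)) = 0" "Re (\<psi> (star x * x)) \<le> 0"
        using that pos_functionalD(4)[OF \<phi>(1), of x] pos_functionalD(4)[OF \<psi>(1), of x] by auto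
      then have "\<phi> (star x * x) = 0"
        using pos_functionalD(3)[OF \<phi>(1), of x] by (simp add: complex_eq_iff)
      then have "star (x * e) * (x * e) = 0"
        using \<phi>(2)[of "star x * x"] e by (simp add: min_proj_def star_mult mult.assoc)
      then show ?thesis using \<psi>(2) \<open>Re (\<psi> (star x * x)) \<le> 0\<close> by simp
    qed
    ultimately show ?case by blast
  qed
  obtain es :: "'a list" where es: "\<And>e. e \<in> set es \<Longrightarrow> min_proj e" "sum_list es = 1"
    using unit_sum_min_proj by blast
  obtain \<psi> where \<psi>: "pos_functional \<psi>"
    "\<And>x. Re (\<psi> (star x * x)) \<le> 0 \<Longrightarrow> \<forall>e\<in>set es. x * e = 0"
    using ind[of es] es(1) by blast
  have "x = 0" if "Re (\<psi> (star x * x)) \<le> 0" for x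
  proof -
    have "x * sum_list es = 0"
      unfolding sum_list_mult_right using \<psi>(2)[OF that] by (simp cong: map_cong)
    then show ?thesis by (simp add: es)
  qed
  then show ?thesis using that \<psi>(1) by blast
qed

section \<open>Schwarz maps\<close>

text \<open>Sums of squares instead of squares: the weakening makes the condition immediate for
  completely positive maps, and positive functionals do not see the difference.\<close>

definition schwarz_map :: "('b::cstar_algebra \<Rightarrow> 'a::cstar_algebra) \<Rightarrow> bool" where
  "schwarz_map F \<longleftrightarrow> (\<forall>x y. F (x + y) = F x + F y) \<and> (\<forall>c x. F (scaleC c x) = scaleC c (F x)) \<and>
     F 1 = 1 \<and> (\<forall>b. \<exists>ys. F (star b * b) = star (F b) * F b + (\<Sum>y\<leftarrow>ys. star y * y))"

lemma schwarz_mapD: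
  assumes "schwarz_map F"
  shows "F (x + y) = F x + F y" "F (scaleC c x) = scaleC c (F x)" "F 1 = 1"
    "F 0 = 0" "F (- x) = - F x" "F (x - y) = F x - F y"
proof -
  show a: "F (x + y) = F x + F y" for x y using assms by (auto simp: schwarz_map_def)
  show "F (scaleC c x) = scaleC c (F x)" "F 1 = 1"
    using assms by (auto simp: schwarz_map_def)
  show z: "F 0 = 0" using a[of 0 0] by simp
  show m: "F (- x) = - F x" for x using a[of x "- x"] z by (simp add: eq_neg_iff_add_eq_0 add.commute)
  show "F (x - y) = F x - F y" using a[of x "- y"] m[of y] by simp
qed

lemma SPU_schwarz_map:
  assumes "SPU F"
  shows "schwarz_map F"
proof -
  have "\<exists>ys. F (star b * b) = star (F b) * F b + (\<Sum>y\<leftarrow>ys. star y * y)" for b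
  proof -
    obtain y where "F (star b * b) - star (F b) * F b = star y * y"
      using assms unfolding SPU_def cstar_le_def cstar_pos_def by blast
    then show ?thesis by (intro exI[of _ "[y]"]) (simp add: diff_eq_eq add.commute)
  qed
  then show ?thesis using assms by (simp add: SPU_def clinear_iff schwarz_map_def)
qed

text \<open>The Schwarz defect is the Schur complement of the positive matrix obtained from
  \<open>[1, b; star b, star b * b]\<close>.\<close>

lemma CPU_schwarz_map:
  fixes F :: "'b::cstar_algebra \<Rightarrow> 'a::cstar_algebra"
  assumes "CPU F"
  shows "schwarz_map F"
proof -
  have "\<exists>ys. F (star b * b) = star (F b) * F b + (\<Sum>y\<leftarrow>ys. star y * y)" for b
  proof -
    \<comment> \<open>The only nonzero row of \<open>Y\<close> is \<open>(1, b)\<close>.\<close>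
    define Y where "Y k i = (if k = 0 then if i = 0 then 1 else b else 0)" for k i :: nat
    define X where "X i j = (\<Sum>k<2. star (Y k i) * Y k j)" for i j
    have X: "X 0 0 = 1" "X 0 1 = b" "X 1 1 = star b * b"
      by (simp_all add: X_def Y_def numeral_2_eq_2)
    have "mat_pos 2 X" unfolding mat_pos_def X_def by blast
    then have "mat_pos 2 (\<lambda>i j. F (X i j))" using assms by (simp add: CPU_def)
    then obtain Z :: "nat \<Rightarrow> nat \<Rightarrow> 'a"
      where Z: "\<And>i j. i < 2 \<Longrightarrow> j < 2 \<Longrightarrow> F (X i j) = (\<Sum>k<2. star (Z k i) * Z k j)"
      unfolding mat_pos_def by blast
    \<comment> \<open>Column 1 of \<open>Z\<close> minus its projection onto column 0, whose square
      is \<open>F 1 = 1\<close>.\<close>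
    define w where "w k = Z k 1 - Z k 0 * F b" for k :: nat
    have F: "F 1 = 1" using assms by (simp add: CPU_def)
    have Z1: "(\<Sum>k<2. star (Z k 0) * Z k 0) = 1" using Z[of 0 0] F unfolding X by simp
    have Zb: "(\<Sum>k<2. star (Z k 0) * Z k 1) = F b" using Z[of 0 1] unfolding X by simp
    have Zb': "(\<Sum>k<2. star (Z k 1) * Z k 0) = star (F b)"
      unfolding Zb[symmetric] by (simp add: star_sum star_mult star_star)
    have Zbb: "(\<Sum>k<2. star (Z k 1) * Z k 1) = F (star b * b)" using Z[of 1 1] unfolding X by simp
    have "(\<Sum>k<2. star (w k) * w k) =
        (\<Sum>k<2. star (Z k 1) * Z k 1) - (\<Sum>k<2. star (Z k 1) * Z k 0) * F b
        - star (F b) * (\<Sum>k<2. star (Z k 0) * Z k 1)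
        + star (F b) * (\<Sum>k<2. star (Z k 0) * Z k 0) * F b"
      by (simp add: w_def star_simps algebra_simps numeral_2_eq_2)
    then have "F (star b * b) = star (F b) * F b + (\<Sum>k<2. star (w k) * w k)"
      unfolding Z1 Zb Zb' Zbb by simp
    then show ?thesis by (intro exI[of _ "[w 0, w 1]"]) (simp add: numeral_2_eq_2)
  qed
  then show ?thesis using assms by (simp add: CPU_def clinear_iff schwarz_map_def)
qed

text \<open>Images of squares are sums of squares, hence self-adjoint; polarizing with
  \<open>1 + scaleC t x\<close> extends this to all elements.\<close>

lemma schwarz_map_star:
  assumes F: "schwarz_map F"
  shows "F (star x) = star (F x)"
proof -
  have sa: "star (F (star b * b)) = F (star b * b)" for b
  proof -
    obtain ys where ys: "F (star b * b) = star (F b) * F b + (\<Sum>y\<leftarrow>ys. star y * y)"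
      using F unfolding schwarz_map_def by blast
    have "star (\<Sum>y\<leftarrow>ys. star y * y) = (\<Sum>y\<leftarrow>ys. star y * y)"
      by (induction ys) (simp_all add: star_simps star_star)
    then show ?thesis unfolding ys by (simp add: star_simps star_star)
  qed
  have "star (1 + scaleC t x) * (1 + scaleC t x) =
      1 + (scaleC t x + scaleC (cnj t) (star x)) + scaleC (cnj t * t) (star x * x)" for t
    by (simp add: star_simps algebra_simps mult_scaleC_left_cstar mult_scaleC_right_cstar scaleC_scaleC)
  then have "star (F (1 + (scaleC t x + scaleC (cnj t) (star x)) + scaleC (cnj t * t) (star x * x)))
      = F (1 + (scaleC t x + scaleC (cnj t) (star x)) + scaleC (cnj t * t) (star x * x))" for t
    using sa by metis
  then have eq: "scaleC (cnj t) (star (F x)) + scaleC t (star (F (star x)))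
      = scaleC t (F x) + scaleC (cnj t) (F (star x))" for t
    using sa[of x] by (simp add: schwarz_mapD[OF F] star_simps algebra_simps)
  have 1: "star (F x) + star (F (star x)) = F x + F (star x)"
    using eq[of 1] by (simp add: scaleC_one)
  have "scaleC \<i> (star (F (star x)) - star (F x)) = scaleC \<i> (F x - F (star x))"
    using eq[of \<i>] by (simp add: cvs.scale_right_diff_distrib)
  then have 2: "star (F (star x)) - star (F x) = F x - F (star x)" by simp
  have "scaleC 2 (F (star x)) = scaleC 2 (star (F x))"
  proof -
    have "F (star x) + F (star x) = star (F x) + star (F x)"
      using arg_cong2[OF 1 2, of minus] by simp
    then show ?thesis
      using scaleC_add_left[of 1 1 "F (star x)"] scaleC_add_left[of 1 1 "star (F x)"]
      by (simp add: scaleC_one)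
  qed
  then show ?thesis by simp
qed

lemma schwarz_map_functional:
  assumes F: "schwarz_map F" and \<phi>: "pos_functional \<phi>"
  shows "Im (\<phi> (F (star b * b))) = 0" "Re (\<phi> (star (F b) * F b)) \<le> Re (\<phi> (F (star b * b)))"
proof -
  obtain ys where ys: "F (star b * b) = star (F b) * F b + (\<Sum>y\<leftarrow>ys. star y * y)"
    using F unfolding schwarz_map_def by blast
  have "Im (\<phi> (\<Sum>y\<leftarrow>ys. star y * y)) = 0 \<and> 0 \<le> Re (\<phi> (\<Sum>y\<leftarrow>ys. star y * y))"
    by (induction ys) (simp_all add: pos_functionalD[OF \<phi>])
  then show "Im (\<phi> (F (star b * b))) = 0" "Re (\<phi> (star (F b) * F b)) \<le> Re (\<phi> (F (star b * b)))"
    unfolding ys by (simp_all add: pos_functionalD[OF \<phi>])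
qed

lemma pos_functional_schwarz_map:
  assumes F: "schwarz_map F" and \<phi>: "pos_functional \<phi>"
  shows "pos_functional (\<lambda>b. \<phi> (F b))"
  unfolding pos_functional_def
  using schwarz_map_functional(1)[OF assms]
    order_trans[OF pos_functionalD(4)[OF \<phi>] schwarz_map_functional(2)[OF assms]]
  by (simp add: schwarz_mapD[OF F] pos_functionalD[OF \<phi>])

section \<open>Modularity\<close>

text \<open>The form \<open>\<omega> (star x * b * y)\<close> has zero diagonal, so every vector is
  null for it.\<close>

lemma pos_functional_polarize:
  assumes \<omega>: "pos_functional \<omega>" and z: "\<And>x. \<omega> (star x * b * x) = 0"
  shows "\<omega> (x * b * y) = 0"
  using sesquilinear_eq_0[of "\<lambda>x y. \<omega> (star x * b * y)" y "star x"] z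
  by (simp add: pos_functionalD[OF \<omega>] star_simps star_star algebra_simps
      mult_scaleC_left_cstar mult_scaleC_right_cstar)

lemma left_ideal_null:
  assumes \<omega>: "pos_functional \<omega>"
  shows "left_ideal {b. \<omega> (star b * b) = 0}"
proof -
  have n: "\<omega> (z * b) = 0" if "\<omega> (star b * b) = 0" for z b
    using pos_functional_null[OF \<omega>, of b z] that by simp
  show ?thesis
    unfolding left_ideal_def cvs.subspace_def
  proof (intro conjI ballI allI)
    fix b c assume "b \<in> {b. \<omega> (star b * b) = 0}" "c \<in> {b. \<omega> (star b * b) = 0}"
    then show "b + c \<in> {b. \<omega> (star b * b) = 0}"
      by (simp add: distrib_left pos_functionalD[OF \<omega>] n)
  next
    fix b c assume "b \<in> {b. \<omega> (star b * b) = 0}"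
    then show "scaleC c b \<in> {b. \<omega> (star b * b) = 0}"
      by (simp add: mult_scaleC_right_cstar pos_functionalD[OF \<omega>] n)
  next
    fix b c assume "b \<in> {b. \<omega> (star b * b) = 0}"
    then show "c * b \<in> {b. \<omega> (star b * b) = 0}"
      by (simp add: n flip: mult.assoc)
  qed (simp add: pos_functionalD[OF \<omega>])
qed

text \<open>\<open>p\<close> is the complement of the right unit \<open>q\<close> of the left kernel
  of \<omega>. As \<open>q\<close> lies in that kernel, \<omega> vanishes on all
  \<open>x * q\<close> and, by stars, on all \<open>q * x\<close>.\<close>

lemma support_projection:
  fixes \<omega> :: "'b::fd_cstar_algebra \<Rightarrow> complex"
  assumes \<omega>: "pos_functional \<omega>"
  obtains p where "star p = p" "p * p = p" "\<And>x. \<omega> (x * p) = \<omega> x" "\<And>x. \<omega> (p * x) = \<omega> x"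
    "\<And>b. \<omega> (star b * b) = 0 \<Longrightarrow> b * p = 0"
proof -
  obtain q where q: "\<omega> (star q * q) = 0" "star q = q" "\<And>n. \<omega> (star n * n) = 0 \<Longrightarrow> n * q = n"
    using left_ideal_unit[OF left_ideal_null[OF \<omega>]] by blast
  have qq: "q * q = q" using q(1,3) by blast
  have xq: "\<omega> (x * q) = 0" for x using pos_functional_null[OF \<omega>, of q x] q(1) by simp
  have qx: "\<omega> (q * x) = 0" for x
    using pos_functional_star[OF \<omega>, of "star x * q"] xq[of "star x"] q(2)
    by (simp add: star_mult star_star)
  show ?thesis
  proof (rule that[of "1 - q"])
    show "\<And>b. \<omega> (star b * b) = 0 \<Longrightarrow> b * (1 - q) = 0" using q(3) by (simp add: right_diff_distrib)
  qed (simp_all add: star_diff q qq xq qx left_diff_distrib right_diff_distrib pos_functionalD[OF \<omega>])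
qed

text \<open>The square of \<open>p * b * f\<close> lies in the corner of \<open>f\<close>, so it is
  a positive multiple of \<open>f\<close>, and rescaling yields \<open>y\<close>.\<close>

lemma min_proj_factor:
  assumes f: "min_proj f" and p: "star p = p" "p * p = p" and b: "p * b * f \<noteq> 0"
  obtains y where "p * y = y" "star y * y = f"
proof -
  have f': "star f = f" using f by (simp add: min_proj_def)
  obtain \<phi> where \<phi>: "pos_functional \<phi>" "\<And>x. f * x * f = scaleC (\<phi> x) f"
    using min_proj_functional[OF f] by blast
  define w where "w = p * b * f"
  define c where "c = \<phi> (star (p * b) * (p * b))"
  have w: "star w * w = scaleC c f"
    unfolding c_def \<phi>(2)[symmetric] by (simp add: w_def star_mult mult.assoc f')
  have "c \<noteq> 0" using w b star_mult_self_eq_0_iff[of w] by (auto simp: w_def)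
  moreover have "Im c = 0" "0 \<le> Re c" using pos_functionalD[OF \<phi>(1)] by (simp_all add: c_def)
  ultimately have c: "c = of_real (Re c)" "Re c > 0" by (auto simp: complex_eq_iff)
  define t where "t = complex_of_real (1 / sqrt (Re c))"
  have "t * (cnj t * c) = 1"
    using c(2) \<open>c \<noteq> 0\<close> by (subst c(1)) (simp add: t_def flip: of_real_mult)
  then have "star (scaleC t w) * scaleC t w = f"
    by (simp add: star_scaleC mult_scaleC_left_cstar mult_scaleC_right_cstar w scaleC_scaleC scaleC_one)
  moreover have "p * scaleC t w = scaleC t w"
    by (simp add: mult_scaleC_right_cstar w_def p flip: mult.assoc)
  ultimately show ?thesis using that by blast
qed

text \<open>For \<open>y = p * y\<close> the error \<open>r = G (F y) - y\<close> satisfies \<open>star r * y = 0\<close>, so the Schwarz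
  inequality gives \<open>G (F (star y * y)) \<ge> star y * y\<close>. As \<open>1\<close> is a sum of minimal
  projections, each of which is such a \<open>star y * y\<close> or is invisible to \<open>\<omega>\<close>, the map
  \<open>b \<mapsto> G (F b) - b\<close> is positive for \<open>\<omega>\<close>; it kills \<open>1\<close>, hence vanishes.\<close>

lemma ae_inverse_null:
  fixes F :: "'b::fd_cstar_algebra \<Rightarrow> 'a::cstar_algebra"
  assumes F: "schwarz_map F" and G: "schwarz_map G" and \<omega>: "pos_functional \<omega>"
    and eq: "\<And>b b'. \<omega> (G (F b) * b') = \<omega> (b * b')"
  shows "\<omega> (x * (G (F b) - b) * y) = 0"
proof -
  define k where "k b = G (F b) - b" for b
  have kadd: "k (b + c) = k b + k c" and kscale: "k (scaleC t b) = scaleC t (k b)" for b c t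
    by (simp_all add: k_def schwarz_mapD[OF F] schwarz_mapD[OF G] cvs.scale_right_diff_distrib)
  have kstar: "star (k b) = k (star b)" for b
    by (simp add: k_def star_diff schwarz_map_star[OF F] schwarz_map_star[OF G])
  have eq': "\<omega> (b' * G (F b)) = \<omega> (b' * b)" for b b'
    using arg_cong[OF eq[of "star b" "star b'"], of cnj]
    by (simp add: star_mult star_star schwarz_map_star[OF F] schwarz_map_star[OF G]
        flip: pos_functional_star[OF \<omega>])
  obtain p where p: "star p = p" "p * p = p" "\<And>x. \<omega> (x * p) = \<omega> x" "\<And>x. \<omega> (p * x) = \<omega> x"
    "\<And>b. \<omega> (star b * b) = 0 \<Longrightarrow> b * p = 0"
    using support_projection[OF \<omega>] by blast
  \<comment> \<open>By \<open>eq'\<close>, multiplying \<open>k b\<close> on the left by anything,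
    in particular by \<open>star (k b)\<close>, gives \<omega>-value zero.\<close>
  have kp: "k b * p = 0" for b
  proof (rule p(5))
    show "\<omega> (star (k b) * k b) = 0"
      by (subst (2) k_def) (simp add: right_diff_distrib pos_functionalD[OF \<omega>] eq')
  qed
  have kp': "star (k b) * p = 0" for b using kp[of "star b"] by (simp add: kstar)
  \<comment> \<open>Polarization reduces the claim to these diagonal values, where \<phi> is a
    vector functional of the GNS representation.\<close>
  have diag: "\<omega> (star u * k b * u) = 0" for u b
  proof -
    define \<phi> where "\<phi> b = \<omega> (star u * b * u)" for b
    have \<phi>: "pos_functional \<phi>" unfolding \<phi>_def by (rule pos_functional_conj[OF \<omega>])
    note \<phi>G = pos_functional_schwarz_map[OF G \<phi>]
    note \<phi>GF = pos_functional_schwarz_map[OF F \<phi>G]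
    have HH: "Re (\<phi> (star (G (F y)) * G (F y))) \<le> Re (\<phi> (G (F (star y * y))))" for y
      using schwarz_map_functional(2)[OF G \<phi>, of "F y"] schwarz_map_functional(2)[OF F \<phi>G, of y]
      by simp
    have k1: "0 \<le> Re (\<phi> (k (star y * y)))" if y: "p * y = y" for y
    proof -
      have "star (k y) * y = 0" using kp'[of y] y by (metis mult.assoc mult_zero_left)
      moreover from this have "star y * k y = 0" by (metis star_mult star_star star_zero)
      moreover have "G (F y) = y + k y" by (simp add: k_def)
      ultimately have "star (G (F y)) * G (F y) = star y * y + star (k y) * k y"
        by (simp add: star_add distrib_left distrib_right)
      then have "Re (\<phi> (star y * y)) \<le> Re (\<phi> (G (F (star y * y))))"
        using HH[of y] pos_functionalD(4)[OF \<phi>, of "k y"] by (simp add: pos_functionalD(1)[OF \<phi>])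
      then show ?thesis by (simp add: k_def pos_functionalD(7)[OF \<phi>])
    qed
    have k2: "0 \<le> Re (\<phi> (k (star c * e * c)))" if e: "min_proj e" for e c
    proof (cases "\<exists>b. p * b * e \<noteq> 0")
      case True
      then obtain y where y: "p * y = y" "star y * y = e"
        using min_proj_factor[OF e p(1,2)] by blast
      have "star c * e * c = star (y * c) * (y * c)"
        by (simp add: star_mult mult.assoc flip: y(2))
      then show ?thesis using k1[of "y * c"] y(1) by (simp add: mult.assoc[symmetric])
    next
      case False
      \<comment> \<open>Since \<omega> absorbs \<open>p\<close> on the left,
        \<open>star c * e * c\<close> is invisible to \<phi>; only the nonnegative term with
        \<open>G\<close> and \<open>F\<close> remains.\<close>
      have "\<phi> (star c * e * c) = \<omega> (p * (star u * star c) * e * (c * u))"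
        using p(4)[of "star u * star c * e * (c * u)"] by (simp add: \<phi>_def mult.assoc)
      then have "\<phi> (star c * e * c) = 0" using False pos_functionalD(5)[OF \<omega>] by auto
      moreover have "star c * e * c = star (e * c) * (e * c)"
        using e by (simp add: min_proj_def star_mult mult.assoc flip: mult.assoc[of e e])
      ultimately show ?thesis using pos_functionalD(4)[OF \<phi>GF, of "e * c"]
        by (simp add: k_def pos_functionalD[OF \<phi>])
    qed
    have k3: "0 \<le> Re (\<phi> (k (star c * sum_list es * c)))" if "\<forall>e\<in>set es. min_proj e" for es c
      using that
    proof (induction es)
      case Nil
      then show ?case using kscale[of 0 0] pos_functionalD(5)[OF \<phi>] by simp
    next
      case (Cons e es)
      then show ?case using k2[of e c]
        by (simp add: distrib_left distrib_right kadd pos_functionalD[OF \<phi>])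
    qed
    obtain es :: "'b list" where es: "\<And>e. e \<in> set es \<Longrightarrow> min_proj e" "sum_list es = 1"
      using unit_sum_min_proj by blast
    have "pos_functional (\<lambda>b. \<phi> (k b))"
      unfolding pos_functional_def
    proof (intro conjI allI)
      fix c
      show "Im (\<phi> (k (star c * c))) = 0"
        using pos_functionalD(3)[OF \<phi>, of c] pos_functionalD(3)[OF \<phi>GF, of c]
        by (simp add: k_def pos_functionalD[OF \<phi>])
      show "0 \<le> Re (\<phi> (k (star c * c)))" using k3[of es c] es by simp
    qed (simp_all add: kadd kscale pos_functionalD[OF \<phi>])
    moreover have "\<phi> (k 1) = 0"
      by (simp add: k_def schwarz_mapD[OF F] schwarz_mapD[OF G] pos_functionalD[OF \<phi>])
    ultimately have "\<phi> (k b) = 0" by (rule pos_functional_zero_of_one)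
    then show ?thesis by (simp add: \<phi>_def)
  qed
  then show ?thesis using pos_functional_polarize[OF \<omega>, of "k b" x y] by (simp add: k_def)
qed

text \<open>\<open>F b\<close> lies in the multiplicative domain of \<open>G\<close>, as seen by \<open>\<omega>\<close>.\<close>

lemma ae_modular_functional:
  fixes F :: "'b::fd_cstar_algebra \<Rightarrow> 'a::cstar_algebra"
  assumes F: "schwarz_map F" and G: "schwarz_map G" and \<omega>: "pos_functional \<omega>"
    and eq: "\<And>b b'. \<omega> (G (F b) * b') = \<omega> (b * b')"
  shows "\<omega> (x * (G (a * F b) - G a * b) * y) = 0"
proof -
  note null = ae_inverse_null[OF F G \<omega> eq]
  have "\<omega> (star u * (G (a * F b) - G a * G (F b)) * u) = 0" for u
  proof -
    define \<phi> where "\<phi> b = \<omega> (star u * b * u)" for b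
    have \<phi>: "pos_functional \<phi>" unfolding \<phi>_def by (rule pos_functional_conj[OF \<omega>])
    \<comment> \<open>Under \<phi>, \<open>G (F b)\<close> may be replaced by \<open>b\<close> at
      either end of a product.\<close>
    have \<phi>0: "\<phi> (c * G (F b)) = \<phi> (c * b)" "\<phi> (G (F b) * c) = \<phi> (b * c)" for b c
      using null[of "star u * c" b u] null[of "star u" b "c * u"]
      by (simp_all add: \<phi>_def mult.assoc left_diff_distrib right_diff_distrib pos_functionalD[OF \<omega>])
    have \<phi>0': "\<phi> (G (F b)) = \<phi> b" for b using \<phi>0(1)[of 1 b] by simp
    \<comment> \<open>The Schwarz defect of \<open>G\<close> under \<phi>, polarized to a positive
      sesquilinear form.\<close>
    define D where "D a c = \<phi> (G (star a * c) - star (G a) * G c)" for a c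
    have "\<phi> (star (G (F b)) * G (F b)) = \<phi> (star b * b)"
      by (simp only: \<phi>0 flip: schwarz_map_star[OF F] schwarz_map_star[OF G])
    \<comment> \<open>The squeeze: the first term of \<open>D (F b) (F b)\<close> is at most
      \<open>\<phi> (star b * b)\<close>, which equals the second term.\<close>
    moreover have "Re (\<phi> (G (star (F b) * F b))) \<le> Re (\<phi> (star b * b))"
      using schwarz_map_functional(2)[OF F pos_functional_schwarz_map[OF G \<phi>], of b] by (simp add: \<phi>0')
    ultimately have "Re (D (F b) (F b)) \<le> 0" by (simp add: D_def pos_functionalD[OF \<phi>])
    moreover have "Im (D c c) = 0" "0 \<le> Re (D c c)" for c
      using schwarz_map_functional[OF G \<phi>, of c] pos_functionalD(3)[OF \<phi>]
      by (simp_all add: D_def pos_functionalD[OF \<phi>])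
    \<comment> \<open>\<open>F b\<close> is a null vector of \<open>D\<close>; the first argument is
      \<open>star a\<close> because \<open>D\<close> stars it.\<close>
    ultimately have "D (star a) (F b) = 0"
      by (intro sesquilinear_eq_0[of D "F b" "star a"])
        (simp_all add: D_def pos_functionalD[OF \<phi>] schwarz_mapD[OF G] star_simps algebra_simps
          mult_scaleC_left_cstar mult_scaleC_right_cstar)
    then show ?thesis by (simp add: D_def \<phi>_def star_star schwarz_map_star[OF G])
  qed
  then have "\<omega> (x * (G (a * F b) - G a * G (F b)) * y) = 0" by (rule pos_functional_polarize[OF \<omega>])
  then show ?thesis using null[of "x * G a" b y]
    by (simp add: mult.assoc left_diff_distrib right_diff_distrib pos_functionalD[OF \<omega>])
qed

text \<open>For the difference \<open>z\<close> of the two arguments of \<xi>, the Schwarz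
  inequality bounds the square of \<open>\<xi> z\<close> by \<open>\<xi> (star z * z)\<close>. The
  functional case makes \<psi> vanish there, and faithfulness of \<psi> gives
  \<open>\<xi> z = 0\<close>.\<close>

lemma schwarz_map_ae_modular:
  fixes F :: "'b::fd_cstar_algebra \<Rightarrow> 'a::cstar_algebra" and \<xi> :: "'b \<Rightarrow> 'c::fd_cstar_algebra"
  assumes F: "schwarz_map F" and G: "schwarz_map G" and \<xi>: "schwarz_map \<xi>"
    and eq: "\<And>b b'. \<xi> (G (F b) * b') = \<xi> (b * b')"
  shows "\<xi> (G (a * F b) * b') = \<xi> (G a * b * b')"
proof -
  obtain \<psi> :: "'c \<Rightarrow> complex" where \<psi>: "pos_functional \<psi>"
    "\<And>x. Re (\<psi> (star x * x)) \<le> 0 \<Longrightarrow> x = 0"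
    using ex_faithful_functional by blast
  define z where "z = (G (a * F b) - G a * b) * b'"
  have "\<psi> (\<xi> (star z * (G (a * F b) - G a * b) * b')) = 0"
    by (rule ae_modular_functional[OF F G pos_functional_schwarz_map[OF \<xi> \<psi>(1)]]) (simp add: eq)
  then have "Re (\<psi> (star (\<xi> z) * \<xi> z)) \<le> 0"
    using schwarz_map_functional(2)[OF \<xi> \<psi>(1), of z] by (simp add: z_def mult.assoc)
  then have "\<xi> z = 0" by (rule \<psi>(2))
  then show ?thesis by (simp add: z_def left_diff_distrib schwarz_mapD[OF \<xi>])
qed

theorem theorem8p9:
  fixes F :: "'b::fd_cstar_algebra \<Rightarrow> 'a::fd_cstar_algebra"
    and G :: "'a \<Rightarrow> 'b"
    and \<xi> :: "'b \<Rightarrow> 'c::fd_cstar_algebra"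
  assumes "(SPU F \<and> SPU G \<and> SPU \<xi>) \<or> (CPU F \<and> CPU G \<and> CPU \<xi>)"
  shows "((\<forall>B B'. \<xi> (G (F B) * B') = \<xi> (B * B')) \<longrightarrow>
           (\<forall>A B B'. \<xi> (G (A * F B) * B') = \<xi> (G A * B * B'))) \<and>
         ((\<forall>B B'. \<xi> (B' * G (F B)) = \<xi> (B' * B)) \<longrightarrow>
           (\<forall>A B B'. \<xi> (B' * G (F B * A)) = \<xi> (B' * B * G A)))"
proof -
  have F: "schwarz_map F" and G: "schwarz_map G" and \<xi>: "schwarz_map \<xi>"
    using assms SPU_schwarz_map CPU_schwarz_map by blast+
  note star_maps = schwarz_map_star[OF F] schwarz_map_star[OF G] schwarz_map_star[OF \<xi>]
  have "\<xi> (B' * G (F B * A)) = \<xi> (B' * B * G A)"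
    if right: "\<forall>B B'. \<xi> (B' * G (F B)) = \<xi> (B' * B)" for A B B'
  proof -
    \<comment> \<open>All three maps preserve stars, so the starred right-handed hypothesis is the
      left-handed one.\<close>
    have "\<xi> (G (F b) * b') = \<xi> (b * b')" for b b'
      using arg_cong[OF right[rule_format, of "star b'" "star b"], of star]
      by (simp add: star_mult star_star flip: star_maps)
    from schwarz_map_ae_modular[OF F G \<xi> this, of "star A" "star B" "star B'"]
    have "star (\<xi> (G (star A * F (star B)) * star B')) = star (\<xi> (G (star A) * star B * star B'))"
      by simp
    then show ?thesis
      by (simp add: star_mult star_star mult.assoc flip: star_maps)
  qed
  then show ?thesis using schwarz_map_ae_modular[OF F G \<xi>] by blast
qed

end
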